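(* Let $K\subset(0,1)$ and $H\subset\mathbb R$ be compact. For $0<p<1$, $q=1-p$, $t\in\mathbb R$ and $k\ge1$ put $$\widetilde A_k(t;p)=\frac{(-1)^{k+1}B_{k+1}-\Xi_k(p)\,B_{k+1}(t)}{k(k+1)},\qquad \Xi_k(p)=\frac{(-1)^{k+1}}{p^k}+\frac1{q^k}.$$ Then, as $N\to\infty$, uniformly for $p\in K$ and $t\in H$ such that $m:=Np+t\in\{0,1,\dots,N\}$, $$b(m;N,p)\sim\frac{Np}{m}\cdot\frac1{\sqrt{2\pi Npq}}\,\exp\Bigl(\sum_{k\ge1}\frac{\widetilde A_k(t;p)}{N^k}\Bigr),$$ in the following sense: for every integer $M\ge0$ there are constants $C$ and $N_0$, depending only on $M$, $K$, $H$, such that for all integers $N\ge N_0$ and all $p\in K$, $t\in H$ with $m=Np+t\in\{0,1,\dots,N\}$ one has $m>0$ and $$b(m;N,p)=\frac{Np}{m}\cdot\frac1{\sqrt{2\pi Npq}}\,\exp\Bigl(\sum_{k=1}^{M}\frac{\widetilde A_k(t;p)}{N^k}\Bigr)\,(1+\varepsilon),\qquad |\varepsilon|\le C N^{-M-1}.$$ (In particular the only dependence of $\widetilde A_k(t;p)$ on $t$ is through the Bernoulli polynomial $B_{k+1}(t)$.)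
   Context: $b(m;N,p)=\binom Nm p^m q^{N-m}$, with $q=1-p$, is the probability that a $\mathrm{Bin}(N,p)$ random variable equals $m$. $B_n(t)$ are the Bernoulli polynomials, $\sum_{n\ge0}B_n(t)z^n/n!=\frac{z}{e^z-1}e^{tz}$, and $B_n=B_n(0)$ are the Bernoulli numbers (so $B_1=-\tfrac12$). *)

theory Defs
  imports "HOL-Probability.Probability" "HOL-Computational_Algebra.Formal_Power_Series"
begin

definition binom_prob :: "nat \<Rightarrow> nat \<Rightarrow> real \<Rightarrow> real" where
  "binom_prob m N p = real (N choose m) * p ^ m * (1 - p) ^ (N - m)"

lemma binom_prob_eq_pmf:
  assumes "0 \<le> p" "p \<le> 1"
  shows "binom_prob m N p = pmf (binomial_pmf N p) m"
  using assms by (simp add: binom_prob_def)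

(* The division is that of formal power series; since fps_exp 1 - 1 has subdegree 1 it is exact,
   see bernoulli_egf_mult. *)
definition bernoulli_egf :: "real \<Rightarrow> real fps" where
  "bernoulli_egf t = fps_X / (fps_exp 1 - 1) * fps_exp t"

definition bernoulli_poly :: "nat \<Rightarrow> real \<Rightarrow> real" where
  "bernoulli_poly n t = fact n * fps_nth (bernoulli_egf t) n"

definition bernoulli_num :: "nat \<Rightarrow> real" where
  "bernoulli_num n = bernoulli_poly n 0"

lemma bernoulli_egf_mult: "(fps_exp 1 - 1) * bernoulli_egf t = fps_X * fps_exp t"
proof -
  have nth1: "fps_nth (fps_exp 1 - 1 :: real fps) 1 = 1"
    by simp
  then have nz: "(fps_exp 1 - 1 :: real fps) \<noteq> 0"
    by (metis fps_zero_nth zero_neq_one)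
  have "subdegree (fps_exp 1 - 1 :: real fps) = 1"
    by (rule subdegreeI) auto
  then have "(fps_exp 1 - 1 :: real fps) dvd fps_X"
    using nz by (simp add: fps_dvd_iff)
  then show ?thesis
    by (simp add: bernoulli_egf_def flip: mult.assoc)
qed

definition Xi :: "nat \<Rightarrow> real \<Rightarrow> real" where
  "Xi k p = (- 1) ^ (k + 1) / p ^ k + 1 / (1 - p) ^ k"

(* Meant for k \<ge> 1 only. *)
definition A_tilde :: "nat \<Rightarrow> real \<Rightarrow> real \<Rightarrow> real" where
  "A_tilde k t p =
     ((- 1) ^ (k + 1) * bernoulli_num (k + 1) - Xi k p * bernoulli_poly (k + 1) t)
       / (real k * real (k + 1))"

end

theory Submission
  imports Defs "HOL-Real_Asymp.Real_Asymp"
begin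

text \<open>
  With N! = N Gamma(N), m! = m Gamma(Np + t) and (N - m)! = Gamma(Nq + 1 - t), everything follows
  from Hermite's form of Stirling's series,
  ln Gamma(x + t) = (x + t - 1/2) ln x - x + ln(2 pi)/2
  + sum of (-1)^(k+1) B_(k+1)(t) / (k (k+1) x^k) over 1 <= k <= M + O(x^(-M-1)),
  uniformly for bounded t, together with B_k(1 - t) = (-1)^k B_k(t).
  For the series itself, let E(x) be the difference of ln Gamma(x + t) and the approximation.
  Expanding in 1/x, the Bernoulli recurrence cancels all coefficients of E(x + 1) - E(x) up to order
  M + 1, so this increment is O(x^(-M-2)); summing it along x, x + 1, ... bounds the distance
  of E(x) from the limit of E(x + n). That limit does not depend on x and t by Gauss' product for
  Gamma, and the duplication formula identifies it as ln(2 pi)/2.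
\<close>

section \<open>Bernoulli polynomials: recurrence, reflection, boundedness\<close>

text \<open>Compare the coefficients of X^(n+1) in \<open>bernoulli_egf_mult\<close>; the summand j
  = n + 1 vanishes because \<open>fps_exp 1 - 1\<close> has no constant term. This recurrence drives
  the cancellation in Stirling's series.\<close>

lemma bernoulli_poly_sum:
  "(\<Sum>j\<le>n. real (Suc n choose j) * bernoulli_poly j t) = real (Suc n) * t ^ n"
proof -
  have "fps_nth ((fps_exp 1 - 1) * bernoulli_egf t) (Suc n) = fps_nth (fps_X * fps_exp t) (Suc n)"
    by (simp only: bernoulli_egf_mult)
  moreover have "fps_nth ((fps_exp 1 - 1) * bernoulli_egf t) (Suc n)
      = (\<Sum>j\<le>Suc n. fps_nth (bernoulli_egf t) j * fps_nth (fps_exp 1 - 1) (Suc n - j))"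
    by (subst mult.commute) (simp only: fps_mult_nth atLeast0AtMost)
  moreover have "\<dots> = (\<Sum>j\<le>n. fps_nth (bernoulli_egf t) j / fact (Suc n - j))"
    by (simp add: divide_inverse Suc_diff_le del: fact_Suc)
  ultimately have *: "(\<Sum>j\<le>n. fps_nth (bernoulli_egf t) j / fact (Suc n - j)) = t ^ n / fact n"
    by simp
  have "(\<Sum>j\<le>n. real (Suc n choose j) * bernoulli_poly j t)
      = fact (Suc n) * (\<Sum>j\<le>n. fps_nth (bernoulli_egf t) j / fact (Suc n - j))"
    unfolding sum_distrib_left
    by (intro sum.cong) (simp_all add: bernoulli_poly_def binomial_fact del: fact_Suc)
  then show ?thesis
    by (simp add: *)
qed

text \<open>Substituting -X for X in the defining equation at 1 - t and multiplying by e^X gives the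
  defining equation at t, from which the nonzero factor \<open>fps_exp 1 - 1\<close> can be
  cancelled.\<close>

lemma bernoulli_poly_reflect: "bernoulli_poly n (1 - t) = (- 1) ^ n * bernoulli_poly n t"
proof -
  define g where "g = fps_compose (bernoulli_egf (1 - t)) (- fps_X)"
  have "fps_compose ((fps_exp 1 - 1) * bernoulli_egf (1 - t)) (- fps_X)
      = fps_compose (fps_X * fps_exp (1 - t)) (- fps_X :: real fps)"
    by (simp only: bernoulli_egf_mult)
  moreover have "fps_compose (fps_exp c) (- fps_X) = fps_exp (- c)" for c :: real
    by (simp add: fps_compose_uminus' fps_eq_iff power_minus[of c])
  ultimately have "(fps_exp (- 1) - 1) * g = - fps_X * fps_exp (t - 1)"
    by (simp add: g_def fps_compose_mult_distrib fps_compose_sub_distrib del: fps_compose_uminus')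
  then have "fps_exp 1 * ((fps_exp (- 1) - 1) * g) = fps_exp 1 * (- fps_X * fps_exp (t - 1))"
    by simp
  then have "(fps_exp 1 * fps_exp (- 1) - fps_exp 1) * g = - fps_X * (fps_exp 1 * fps_exp (t - 1))"
    by (simp add: algebra_simps)
  then have "(1 - fps_exp 1) * g = - fps_X * fps_exp t"
    by (simp flip: fps_exp_add_mult)
  then have "(fps_exp 1 - 1) * g = fps_X * fps_exp t"
    by (simp add: algebra_simps)
  then have "(fps_exp 1 - 1) * g = (fps_exp 1 - 1) * bernoulli_egf t"
    by (simp add: bernoulli_egf_mult)
  moreover have "fps_nth (fps_exp 1 - 1 :: real fps) 1 \<noteq> 0"
    by simp
  then have "fps_exp 1 - 1 \<noteq> (0 :: real fps)"
    by (metis fps_zero_nth)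
  ultimately have "g = bernoulli_egf t"
    by simp
  then have "fps_nth g n = fps_nth (bernoulli_egf t) n"
    by simp
  then have "(- 1) ^ n * fps_nth (bernoulli_egf (1 - t)) n = fps_nth (bernoulli_egf t) n"
    by (simp add: g_def fps_compose_uminus')
  then have "fps_nth (bernoulli_egf (1 - t)) n = (- 1) ^ n * fps_nth (bernoulli_egf t) n"
    by (metis minus_one_mult_self mult.assoc mult_1)
  then show ?thesis
    by (simp add: bernoulli_poly_def)
qed

lemma continuous_on_bernoulli_poly: "continuous_on S (bernoulli_poly n)"
  unfolding bernoulli_poly_def bernoulli_egf_def fps_mult_nth fps_exp_nth
  by (intro continuous_intros) auto

lemma bernoulli_poly_bounded:
  obtains B where "\<And>t. \<bar>t\<bar> \<le> T \<Longrightarrow> \<bar>bernoulli_poly n t\<bar> \<le> B"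
proof -
  have "compact (bernoulli_poly n ` {-T..T})"
    by (intro compact_continuous_image continuous_on_bernoulli_poly compact_Icc)
  then obtain B where "\<forall>y \<in> bernoulli_poly n ` {-T..T}. \<bar>y\<bar> \<le> B"
    using compact_imp_bounded bounded_iff by (metis real_norm_def)
  then have "\<bar>bernoulli_poly n t\<bar> \<le> B" if "\<bar>t\<bar> \<le> T" for t
    using that by (auto simp: abs_le_iff)
  then show ?thesis by (rule that)
qed

section \<open>Power series with uniform remainder bounds\<close>

text \<open>The tail is z^n times a series dominated on |z| <= s by its absolute values at s, whose
  sum serves as \<open>C\<close>. The bound holds on the whole interval, so it may be used at t/x
  uniformly in t.\<close>

lemma power_series_remainder:
  fixes f :: "real \<Rightarrow> real"
  assumes "\<And>z. \<bar>z\<bar> < r \<Longrightarrow> (\<lambda>i. a i * z ^ i) sums f z" and "0 < s" "s < r"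
  obtains C where "C \<ge> 0" "\<And>z. \<bar>z\<bar> \<le> s \<Longrightarrow> \<bar>f z - (\<Sum>i<n. a i * z ^ i)\<bar> \<le> C * \<bar>z\<bar> ^ n"
proof -
  have sm: "summable (\<lambda>i. \<bar>a (i + n)\<bar> * s ^ i)"
  proof -
    have "summable (\<lambda>i. norm (a i * s ^ i))"
      \<comment> \<open>Convergence at a point strictly beyond s gives absolute convergence at
        s.\<close>
      using assms(1)[of "(s + r) / 2"] assms(2,3)
      by (intro powser_insidea[where x = "(s + r) / 2"]) (auto simp: sums_iff)
    then have "summable (\<lambda>i. norm (a (i + n) * s ^ (i + n)) * (1 / s ^ n))"
      by (intro summable_mult2) (subst summable_iff_shift)
    then show ?thesis
      using assms(2) by (simp add: abs_mult power_add)
  qed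
  define C where "C = (\<Sum>i. \<bar>a (i + n)\<bar> * s ^ i)"
  have "C \<ge> 0"
    using assms(2) by (auto simp: C_def intro!: suminf_nonneg sm)
  moreover have "\<bar>f z - (\<Sum>i<n. a i * z ^ i)\<bar> \<le> C * \<bar>z\<bar> ^ n" if z: "\<bar>z\<bar> \<le> s" for z
  proof -
    have "(\<lambda>i. a (i + n) * z ^ (i + n)) sums (f z - (\<Sum>i<n. a i * z ^ i))"
      using assms z by (intro sums_split_initial_segment) auto
    then have eq: "f z - (\<Sum>i<n. a i * z ^ i) = (\<Sum>i. a (i + n) * z ^ (i + n))"
      by (simp add: sums_iff)
    have le: "norm (a (i + n) * z ^ (i + n)) \<le> \<bar>a (i + n)\<bar> * s ^ i * \<bar>z\<bar> ^ n" for i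
      using z by (auto simp: abs_mult power_add power_abs mult.assoc intro!: mult_left_mono mult_right_mono power_mono)
    have "norm (\<Sum>i. a (i + n) * z ^ (i + n)) \<le> (\<Sum>i. \<bar>a (i + n)\<bar> * s ^ i * \<bar>z\<bar> ^ n)"
      by (intro norm_suminf_le le summable_mult2 sm)
    then show ?thesis
      by (simp add: eq C_def suminf_mult2[OF sm])
  qed
  ultimately show ?thesis by (rule that)
qed

lemma ln_one_plus_sums:
  fixes z :: real
  assumes "\<bar>z\<bar> < 1"
  shows "(\<lambda>i. fps_nth (fps_ln 1) i * z ^ i) sums ln (1 + z)"
proof -
  have "summable (\<lambda>i. fps_nth (fps_ln 1) i * z ^ i)"
    using assms by (intro summable_fps) (simp add: fps_conv_radius_ln)
  then have "summable (\<lambda>i. fps_nth (fps_ln 1) (Suc i) * z ^ Suc i)"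
    by (subst summable_Suc_iff)
  moreover have eq: "fps_nth (fps_ln 1) (Suc i) * z ^ Suc i = (- 1) ^ i * (1 / real (i + 1)) * z ^ Suc i" for i
    by (simp add: fps_ln_def)
  ultimately have "(\<lambda>i. fps_nth (fps_ln 1) (Suc i) * z ^ Suc i) sums ln (1 + z)"
    using assms ln_series[of "1 + z"] by (simp add: sums_iff eq del: power_Suc)
  then show ?thesis
    by (subst (asm) sums_Suc_iff) (simp add: fps_ln_def)
qed

text \<open>Binomial series with exponent -k, used to expand 1/(x+1)^k in powers of 1/x.\<close>

lemma inverse_power_sums:
  fixes z :: real
  assumes "\<bar>z\<bar> < 1"
  shows "(\<lambda>i. ((- real k) gchoose i) * z ^ i) sums (1 / (1 + z) ^ k)"
proof -
  have "(1 + z) powr (- real k) = 1 / (1 + z) ^ k"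
    using assms by (simp add: powr_minus powr_realpow divide_inverse)
  then show ?thesis
    using gen_binomial_real[OF assms, of "- real k"] by simp
qed

section \<open>Coefficients of Hermite's form of Stirling's series\<close>

lemma bernoulli_poly_0: "bernoulli_poly 0 t = 1"
  using bernoulli_poly_sum[of 0 t] by simp

lemma bernoulli_poly_1: "bernoulli_poly 1 t = t - 1 / 2"
  using bernoulli_poly_sum[of 1 t] by (simp add: bernoulli_poly_0)

text \<open>At t = 0 and k >= 1 these are the coefficients of the classical Stirling series.\<close>

definition stirling_coeff :: "nat \<Rightarrow> real \<Rightarrow> real" where
  "stirling_coeff k t = (- 1) ^ (k + 1) * bernoulli_poly (k + 1) t / (real k * real (k + 1))"

text \<open>The constant ln(2 pi)/2 is left out: it cancels in increments and is recovered at the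
  end as the limit of the error.\<close>

definition stirling_approx :: "nat \<Rightarrow> real \<Rightarrow> real \<Rightarrow> real" where
  "stirling_approx M x t = (x + t - 1 / 2) * ln x - x + (\<Sum>k=1..M. stirling_coeff k t / x ^ k)"

text \<open>Negating the upper index turns the generalized binomial into +-(i-1 choose k-1), and
  absorbing factors twice gives k(k+1)(i+1 choose k+1) = i(i+1)(i-1 choose k-1). The prefactor is
  then free of k, so summing over k becomes the Bernoulli recurrence.\<close>

lemma stirling_coeff_mult_gbinomial:
  assumes "1 \<le> k" "k < i"
  shows "stirling_coeff k t * ((- real k) gchoose (i - k))
       = (- 1) ^ (i + 1) / (real i * real (i + 1)) * (real (Suc i choose Suc k) * bernoulli_poly (Suc k) t)"
proof -
  obtain j k' where j: "i = Suc j" "k = Suc k'"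
    using assms by (metis not_less_zero old.nat.exhaust Suc_le_D One_nat_def)
  have "(- real k) gchoose (i - k) = (- 1) ^ (i - k) * (real j gchoose (i - k))"
    using assms j by (subst gbinomial_minus) (simp add: of_nat_diff algebra_simps)
  also have "\<dots> = (- 1) ^ (i - k) * real (j choose k')"
    using assms j by (simp add: binomial_symmetric[of k' j] flip: binomial_gbinomial)
  finally have g: "(- real k) gchoose (i - k) = (- 1) ^ (i - k) * real (j choose k')" .
  have sign: "(- 1 :: real) ^ (k + 1) * (- 1) ^ (i - k) = (- 1) ^ (i + 1)"
    using assms by (simp flip: power_add)
  have "real k * real (k + 1) * real (Suc i choose Suc k) = real i * real (i + 1) * real (j choose k')"
  proof -
    have "k * (k + 1) * (Suc i choose Suc k) = i * (i + 1) * (j choose k')"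
    proof -
      have "k * (k + 1) * (Suc i choose Suc k) = k * (Suc k * (Suc i choose Suc k))"
        by (simp only: Suc_eq_plus1 mult.assoc)
      also have "\<dots> = Suc i * (k * (i choose k))"
        by (simp only: Suc_times_binomial mult.left_commute)
      also have "k * (i choose k) = i * (j choose k')"
        by (simp only: j Suc_times_binomial)
      finally show ?thesis
        by (simp only: Suc_eq_plus1 ac_simps)
    qed
    then show ?thesis
      by (metis of_nat_mult)
  qed
  then have "real (j choose k') / (real k * real (k + 1)) = real (Suc i choose Suc k) / (real i * real (i + 1))"
    using assms by (subst frac_eq_eq) (simp_all only: ac_simps, simp_all)
  moreover have "stirling_coeff k t * ((- real k) gchoose (i - k))
      = ((- 1) ^ (k + 1) * (- 1) ^ (i - k)) * bernoulli_poly (Suc k) t * (real (j choose k') / (real k * real (k + 1)))"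
    by (simp add: stirling_coeff_def g)
  ultimately show ?thesis
    by (simp only: sign) simp
qed

text \<open>The left side is the coefficient of x^(-i) in the increment of
  \<open>stirling_approx\<close> minus \<open>ln (x + t)\<close>. It vanishes by the Bernoulli
  recurrence, once the terms with indices 0 and 1 are split off.\<close>

lemma stirling_coeff_recurrence:
  assumes "i \<le> M + 1"
  shows "fps_nth (fps_ln 1) (Suc i) + (t + 1 / 2) * fps_nth (fps_ln 1) i - fps_nth (fps_ln 1) i * t ^ i
      - (if i = 0 then 1 else 0)
      + (\<Sum>k=1..M. stirling_coeff k t * (if k < i then (- real k) gchoose (i - k) else 0)) = 0"
proof (cases i)
  case (Suc j)
  have "(\<Sum>k=1..M. stirling_coeff k t * (if k < i then (- real k) gchoose (i - k) else 0))
      = (\<Sum>k=1..j. stirling_coeff k t * ((- real k) gchoose (i - k)))"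
    \<comment> \<open>Since i <= M + 1, the range up to M contains every k < i.\<close>
    using assms Suc by (intro sum.mono_neutral_cong_right) auto
  also have "\<dots> = (- 1) ^ (i + 1) / (real i * real (i + 1))
      * (\<Sum>k=1..j. real (Suc i choose Suc k) * bernoulli_poly (Suc k) t)"
    unfolding sum_distrib_left using Suc
    by (intro sum.cong refl stirling_coeff_mult_gbinomial) auto
  also have "(\<Sum>k=1..j. real (Suc i choose Suc k) * bernoulli_poly (Suc k) t)
      = real (Suc i) * t ^ i - 1 - real (Suc i) * (t - 1 / 2)"
  proof -
    have "(\<Sum>k\<le>i. real (Suc i choose k) * bernoulli_poly k t)
        = bernoulli_poly 0 t + (real (Suc i) * bernoulli_poly 1 t
          + (\<Sum>k=1..j. real (Suc i choose Suc k) * bernoulli_poly (Suc k) t))"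
      unfolding Suc sum.atMost_Suc_shift
      by (subst sum.atMost_shift) (simp add: sum.atLeast1_atMost_eq del: binomial_Suc_Suc)
    then show ?thesis
      by (simp add: bernoulli_poly_sum bernoulli_poly_0 bernoulli_poly_1 del: One_nat_def binomial_Suc_Suc)
  qed
  finally have sum_eq: "(\<Sum>k=1..M. stirling_coeff k t * (if k < i then (- real k) gchoose (i - k) else 0))
      = (- 1) ^ (i + 1) / (real i * real (i + 1)) * (real (Suc i) * t ^ i - 1 - real (Suc i) * (t - 1 / 2))" .
  have coeffs: "fps_nth (fps_ln 1) i = (- 1) ^ j / (real j + 1)"
    "fps_nth (fps_ln 1) (Suc i) = - ((- 1) ^ j / (real j + 2))"
    by (simp_all add: Suc fps_ln_nth)
  \<comment> \<open>With the sign (-1)^j and the power t^i abstracted to \<open>a\<close> and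
    \<open>T\<close>, a rational identity in r = j remains.\<close>
  have "- (a / (r + 2)) + (t + 1 / 2) * (a / (r + 1)) - a / (r + 1) * T
      + a / ((r + 1) * (r + 2)) * ((r + 2) * T - 1 - (r + 2) * (t - 1 / 2)) = 0"
    if "r \<ge> 0" for a r T :: real
  proof -
    have "r + 1 \<noteq> 0" "r + 2 \<noteq> 0"
      using that by auto
    then show ?thesis
      by (simp add: divide_simps) algebra
  qed
  from this[of "real j" "(- 1) ^ j" "t ^ i"]
  show ?thesis
    unfolding sum_eq coeffs by (simp add: Suc add.commute)
qed (simp add: fps_ln_nth)

section \<open>The increment of the approximation is O(x^(-M-2))\<close>

text \<open>As \<open>ln (x + t)\<close> is the increment of \<open>ln (Gamma (x + t))\<close>, the
  left side is minus the increment of the error. The right side is arranged for expansion in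
  1/x.\<close>

lemma stirling_approx_diff:
  assumes "x > 0" and "x + t > 0"
  shows "stirling_approx M (x + 1) t - stirling_approx M x t - ln (x + t)
     = (x + t + 1 / 2) * ln (1 + 1 / x) - 1 - ln (1 + t * (1 / x))
       + (\<Sum>k=1..M. stirling_coeff k t * (1 / x) ^ k * (1 / (1 + 1 / x) ^ k - 1))"
proof -
  have "ln (1 + 1 / x) = ln (x + 1) - ln x"
  proof -
    have "1 + 1 / x = (x + 1) / x"
      using assms by (simp add: add_divide_distrib)
    then show ?thesis
      using assms by (simp add: ln_div)
  qed
  moreover have "ln (1 + t * (1 / x)) = ln (x + t) - ln x"
  proof -
    have "1 + t * (1 / x) = (x + t) / x"
      using assms by (simp add: add_divide_distrib)
    then show ?thesis
      using assms by (simp add: ln_div)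
  qed
  moreover have "stirling_coeff k t * (1 / x) ^ k * (1 / (1 + 1 / x) ^ k - 1)
      = stirling_coeff k t / (x + 1) ^ k - stirling_coeff k t / x ^ k" for k
  proof -
    have "1 / x * (1 / (1 + 1 / x)) = 1 / (x + 1)"
      using assms by (simp add: field_simps)
    then have "(1 / x) ^ k * (1 / (1 + 1 / x) ^ k) = 1 / (x + 1) ^ k"
      by (metis power_mult_distrib power_one_over)
    then have "stirling_coeff k t * ((1 / x) ^ k * (1 / (1 + 1 / x) ^ k) - (1 / x) ^ k)
        = stirling_coeff k t * (1 / (x + 1) ^ k - 1 / x ^ k)"
      by (simp only: power_one_over)
    then show ?thesis
      by (simp only: right_diff_distrib mult_1_right mult.assoc times_divide_eq_right)
  qed
  ultimately show ?thesis
    by (simp only: stirling_approx_def sum_subtractf) (simp add: algebra_simps)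
qed

text \<open>
  Replacing each function of u by its Taylor remainder changes nothing, because the Taylor
  polynomials cancel by the recurrence above. The first sum is one term longer since it is
  multiplied by x = 1/u.
\<close>

lemma stirling_approx_diff_split:
  fixes M :: nat and x t :: real
  defines "u \<equiv> 1 / x" and "n \<equiv> M + 2"
  assumes "x > 0" and "x + t > 0"
  shows "stirling_approx M (x + 1) t - stirling_approx M x t - ln (x + t)
     = x * (ln (1 + u) - (\<Sum>i<Suc n. fps_nth (fps_ln 1) i * u ^ i))
       + (t + 1 / 2) * (ln (1 + u) - (\<Sum>i<n. fps_nth (fps_ln 1) i * u ^ i))
       - (ln (1 + t * u) - (\<Sum>i<n. fps_nth (fps_ln 1) i * (t * u) ^ i))
       + (\<Sum>k=1..M. stirling_coeff k t * u ^ k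
            * (1 / (1 + u) ^ k - (\<Sum>i<n - k. ((- real k) gchoose i) * u ^ i)))"
    (is "_ = ?R")
proof -
  have u: "x * u = 1"
    using assms by simp
  have P1: "x * (\<Sum>i<Suc n. fps_nth (fps_ln 1) i * u ^ i) = (\<Sum>i<n. fps_nth (fps_ln 1) (Suc i) * u ^ i)"
  proof -
    have "(\<Sum>i<Suc n. fps_nth (fps_ln 1) i * u ^ i) = u * (\<Sum>i<n. fps_nth (fps_ln 1) (Suc i) * u ^ i)"
      by (simp add: sum.lessThan_Suc_shift sum_distrib_left ac_simps del: sum.lessThan_Suc)
    then show ?thesis
      by (simp only: u mult_1 flip: mult.assoc)
  qed
  have P2: "(\<Sum>i<n. (if i = 0 then 1 else 0) * u ^ i) = 1"
    by (simp add: n_def sum.lessThan_Suc_shift del: sum.lessThan_Suc)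
  \<comment> \<open>Dropping the constant term 1 leaves only powers above k. Padding with zeros to
    all i < n makes the range independent of k, so that the sums over i and k can be
    swapped.\<close>
  have P3: "u ^ k * ((\<Sum>i<n - k. ((- real k) gchoose i) * u ^ i) - 1)
      = (\<Sum>i<n. (if k < i then (- real k) gchoose (i - k) else 0) * u ^ i)" if k: "k \<in> {1..M}" for k
  proof -
    obtain d where d: "n - k = Suc d"
      using k by (cases "n - k") (auto simp: n_def)
    have "u ^ k * ((\<Sum>i<n - k. ((- real k) gchoose i) * u ^ i) - 1)
        = (\<Sum>i<d. ((- real k) gchoose Suc i) * u ^ (Suc i + k))"
      by (simp add: d sum.lessThan_Suc_shift sum_distrib_left power_add ac_simps del: sum.lessThan_Suc)
    also have "\<dots> = (\<Sum>i\<in>{Suc k..<n}. ((- real k) gchoose (i - k)) * u ^ i)"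
      using d by (intro sum.reindex_bij_witness[of _ "\<lambda>i. i - Suc k" "\<lambda>i. Suc i + k"]) (auto simp: Suc_diff_le)
    also have "\<dots> = (\<Sum>i<n. (if k < i then (- real k) gchoose (i - k) else 0) * u ^ i)"
      by (intro sum.mono_neutral_cong_left) auto
    finally show ?thesis .
  qed
  \<comment> \<open>Zero is written as a combination of the recurrences; i < n is exactly their
    range i <= M + 1.\<close>
  have "0 = (\<Sum>i<n. (fps_nth (fps_ln 1) (Suc i) + (t + 1 / 2) * fps_nth (fps_ln 1) i
      - fps_nth (fps_ln 1) i * t ^ i - (if i = 0 then 1 else 0)
      + (\<Sum>k=1..M. stirling_coeff k t * (if k < i then (- real k) gchoose (i - k) else 0))) * u ^ i)"
    by (intro sum.neutral[symmetric] ballI) (subst stirling_coeff_recurrence, auto simp: n_def)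
  also have "\<dots> = (\<Sum>i<n. fps_nth (fps_ln 1) (Suc i) * u ^ i)
      + (t + 1 / 2) * (\<Sum>i<n. fps_nth (fps_ln 1) i * u ^ i)
      - (\<Sum>i<n. fps_nth (fps_ln 1) i * (t * u) ^ i) - (\<Sum>i<n. (if i = 0 then 1 else 0) * u ^ i)
      + (\<Sum>i<n. \<Sum>k=1..M. stirling_coeff k t * ((if k < i then (- real k) gchoose (i - k) else 0) * u ^ i))"
    by (simp only: distrib_right left_diff_distrib sum.distrib sum_subtractf sum_distrib_left sum_distrib_right
        power_mult_distrib mult.assoc)
  also have "(\<Sum>i<n. \<Sum>k=1..M. stirling_coeff k t * ((if k < i then (- real k) gchoose (i - k) else 0) * u ^ i))
      = (\<Sum>k=1..M. stirling_coeff k t * (u ^ k * ((\<Sum>i<n - k. ((- real k) gchoose i) * u ^ i) - 1)))"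
    by (subst sum.swap) (simp only: P3 sum_distrib_left[symmetric] cong: sum.cong)
  finally have "0 = x * (\<Sum>i<Suc n. fps_nth (fps_ln 1) i * u ^ i)
      + (t + 1 / 2) * (\<Sum>i<n. fps_nth (fps_ln 1) i * u ^ i)
      - (\<Sum>i<n. fps_nth (fps_ln 1) i * (t * u) ^ i) - 1
      + (\<Sum>k=1..M. stirling_coeff k t * (u ^ k * ((\<Sum>i<n - k. ((- real k) gchoose i) * u ^ i) - 1)))"
    by (simp only: P1 P2)
  moreover have "(\<Sum>k=1..M. stirling_coeff k t * u ^ k * (1 / (1 + u) ^ k - 1))
      = (\<Sum>k=1..M. stirling_coeff k t * u ^ k
            * (1 / (1 + u) ^ k - (\<Sum>i<n - k. ((- real k) gchoose i) * u ^ i)))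
        + (\<Sum>k=1..M. stirling_coeff k t * (u ^ k * ((\<Sum>i<n - k. ((- real k) gchoose i) * u ^ i) - 1)))"
    unfolding sum.distrib[symmetric] by (intro sum.cong refl) (simp add: algebra_simps)
  ultimately show ?thesis
    unfolding stirling_approx_diff[OF assms(3,4)] u_def[symmetric]
    by (simp only: right_diff_distrib distrib_right)
qed

lemma stirling_coeff_bounded:
  obtains B where "\<And>t. \<bar>t\<bar> \<le> T \<Longrightarrow> \<bar>stirling_coeff k t\<bar> \<le> B"
proof -
  obtain B where "\<And>t. \<bar>t\<bar> \<le> T \<Longrightarrow> \<bar>bernoulli_poly (k + 1) t\<bar> \<le> B"
    using bernoulli_poly_bounded by blast
  then have "\<bar>stirling_coeff k t\<bar> \<le> B / (real k * real (k + 1))" if "\<bar>t\<bar> \<le> T" for t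
    using that by (auto simp: stirling_coeff_def abs_mult power_abs intro!: divide_right_mono)
  then show ?thesis by (rule that)
qed

text \<open>Every term of the split is O(u^n) with u = 1/x and n = M + 2: the extra order of the
  first remainder pays for the factor x, and u^k completes the remainder of order n - k.\<close>

lemma stirling_approx_diff_bound:
  assumes "T \<ge> 0"
  obtains C where "C \<ge> 0" "\<And>x t. \<bar>t\<bar> \<le> T \<Longrightarrow> x \<ge> 2 * T + 2 \<Longrightarrow>
      \<bar>stirling_approx M (x + 1) t - stirling_approx M x t - ln (x + t)\<bar> \<le> C / x ^ (M + 2)"
proof -
  define n where "n = M + 2"
  define L where "L = (\<lambda>n z. ln (1 + z) - (\<Sum>i<n. fps_nth (fps_ln 1) i * z ^ i) :: real)"
  define P where "P = (\<lambda>k z. 1 / (1 + z) ^ k - (\<Sum>i<n - k. ((- real k) gchoose i) * z ^ i))"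
  have "\<exists>C\<ge>0. \<forall>z. \<bar>z\<bar> \<le> 1 / 2 \<longrightarrow> \<bar>L n z\<bar> \<le> C * \<bar>z\<bar> ^ n" for n
    unfolding L_def by (rule power_series_remainder[OF ln_one_plus_sums, where s = "1 / 2" and n = n]) auto
  then obtain CL where CL: "CL n \<ge> 0" "\<bar>z\<bar> \<le> 1 / 2 \<Longrightarrow> \<bar>L n z\<bar> \<le> CL n * \<bar>z\<bar> ^ n" for n z
    by metis
  have "\<exists>C\<ge>0. \<forall>z. \<bar>z\<bar> \<le> 1 / 2 \<longrightarrow> \<bar>P k z\<bar> \<le> C * \<bar>z\<bar> ^ (n - k)" for k
    unfolding P_def by (rule power_series_remainder[OF inverse_power_sums, where s = "1 / 2" and n = "n - k"]) auto
  then obtain CP where CP: "CP k \<ge> 0" "\<bar>z\<bar> \<le> 1 / 2 \<Longrightarrow> \<bar>P k z\<bar> \<le> CP k * \<bar>z\<bar> ^ (n - k)" for k z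
    by metis
  have "\<exists>B. \<forall>t. \<bar>t\<bar> \<le> T \<longrightarrow> \<bar>stirling_coeff k t\<bar> \<le> B" for k
    by (rule stirling_coeff_bounded) auto
  then obtain B where B: "\<bar>t\<bar> \<le> T \<Longrightarrow> \<bar>stirling_coeff k t\<bar> \<le> B k" for k t
    by metis
  have Bnn: "B k \<ge> 0" for k
    using B[of 0 k] assms by simp
  define C where "C = CL (Suc n) + (T + 1 / 2) * CL n + CL n * T ^ n + (\<Sum>k=1..M. B k * CP k)"
  have "C \<ge> 0"
    using assms CL(1) CP(1) Bnn by (auto simp: C_def intro!: add_nonneg_nonneg mult_nonneg_nonneg sum_nonneg)
  moreover have "\<bar>stirling_approx M (x + 1) t - stirling_approx M x t - ln (x + t)\<bar> \<le> C / x ^ (M + 2)"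
    if t: "\<bar>t\<bar> \<le> T" and x: "x \<ge> 2 * T + 2" for x t
  proof -
    define u where "u = 1 / x"
    have pos: "x > 0" "x + t > 0"
      using t x by auto
    \<comment> \<open>The lower bound on x puts both u and t * u into |z| <= 1/2, where the
      remainder bounds hold.\<close>
    have u: "0 < u" "u \<le> 1 / 2" "x * u = 1"
      using x assms by (auto simp: u_def field_simps)
    have tu: "\<bar>t * u\<bar> \<le> T * u" "T * u \<le> 1 / 2"
      using x t assms pos u by (auto simp: abs_mult u_def field_simps intro!: mult_right_mono divide_right_mono)
    have b1: "\<bar>x * L (Suc n) u\<bar> \<le> CL (Suc n) * u ^ n"
    proof -
      have "\<bar>x * L (Suc n) u\<bar> \<le> x * (CL (Suc n) * u ^ Suc n)"
        using CL(2)[of u "Suc n"] u pos by (auto simp: abs_mult intro!: mult_left_mono)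
      also have "\<dots> = CL (Suc n) * u ^ n * (x * u)"
        by simp
      finally show ?thesis
        using u by simp
    qed
    have b2: "\<bar>(t + 1 / 2) * L n u\<bar> \<le> (T + 1 / 2) * CL n * u ^ n"
      unfolding abs_mult mult.assoc
      using CL(2)[of u n] u t assms by (intro mult_mono) auto
    have b3: "\<bar>L n (t * u)\<bar> \<le> CL n * T ^ n * u ^ n"
    proof -
      have "\<bar>L n (t * u)\<bar> \<le> CL n * \<bar>t * u\<bar> ^ n"
        using tu by (intro CL(2)) auto
      also have "\<dots> \<le> CL n * (T * u) ^ n"
        using tu CL(1) by (intro mult_left_mono power_mono) auto
      finally show ?thesis
        by (simp add: power_mult_distrib mult.assoc)
    qed
    have b4: "\<bar>\<Sum>k=1..M. stirling_coeff k t * u ^ k * P k u\<bar> \<le> (\<Sum>k=1..M. B k * CP k) * u ^ n"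
      unfolding sum_distrib_right
    proof (rule sum_abs[THEN order_trans], rule sum_mono)
      fix k assume k: "k \<in> {1..M}"
      have "\<bar>stirling_coeff k t * u ^ k * P k u\<bar> = \<bar>stirling_coeff k t\<bar> * (u ^ k * \<bar>P k u\<bar>)"
        using u by (simp add: abs_mult)
      also have "\<dots> \<le> B k * (u ^ k * (CP k * u ^ (n - k)))"
        using CP(2)[of u k] u B[OF t, of k] Bnn[of k] by (intro mult_mono) auto
      also have "\<dots> = B k * CP k * (u ^ k * u ^ (n - k))"
        by simp
      also have "u ^ k * u ^ (n - k) = u ^ n"
        using k by (simp add: n_def flip: power_add)
      finally show "\<bar>stirling_coeff k t * u ^ k * P k u\<bar> \<le> B k * CP k * u ^ n" .
    qed
    have "stirling_approx M (x + 1) t - stirling_approx M x t - ln (x + t)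
        = x * L (Suc n) u + (t + 1 / 2) * L n u - L n (t * u) + (\<Sum>k=1..M. stirling_coeff k t * u ^ k * P k u)"
      unfolding L_def P_def n_def u_def by (rule stirling_approx_diff_split[OF pos])
    moreover have "C * u ^ n = CL (Suc n) * u ^ n + (T + 1 / 2) * CL n * u ^ n + CL n * T ^ n * u ^ n
        + (\<Sum>k=1..M. B k * CP k) * u ^ n"
      by (simp add: C_def algebra_simps)
    ultimately have "\<bar>stirling_approx M (x + 1) t - stirling_approx M x t - ln (x + t)\<bar> \<le> C * u ^ n"
      using b1 b2 b3 b4 by linarith
    then show ?thesis
      by (simp add: u_def n_def power_one_over)
  qed
  ultimately show ?thesis by (rule that)
qed

section \<open>Summing the increments of the error\<close>

text \<open>A discrete form of integral comparison that makes sums of 1/y^(m+2) telescope. It rests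
  on a - b = a * b for a = 1/(y-1) and b = 1/y.\<close>

lemma inverse_power_le_diff:
  fixes y :: real
  assumes "y > 1"
  shows "1 / y ^ (m + 2) \<le> 1 / (y - 1) ^ (m + 1) - 1 / y ^ (m + 1)"
proof -
  define a b where "a = 1 / (y - 1)" and "b = 1 / y"
  have ab: "0 < b" "b \<le> a" "a - b = a * b"
    using assms by (auto simp: a_def b_def field_simps)
  have "b ^ (m + 2) = b ^ m * (b * b)"
    by (simp add: power2_eq_square)
  also have "\<dots> \<le> b ^ m * (a * b)"
    using ab by (intro mult_left_mono mult_right_mono) auto
  also have "\<dots> = a * b ^ m - b ^ (m + 1)"
    by (simp flip: ab(3) add: algebra_simps)
  also have "\<dots> \<le> a * a ^ m - b ^ (m + 1)"
    using ab by (intro diff_right_mono mult_left_mono power_mono) auto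
  finally show ?thesis
    by (simp add: a_def b_def power_one_over divide_inverse power_inverse)
qed

lemma ln_Gamma_plus_one:
  fixes z :: real
  assumes "z > 0"
  shows "ln (Gamma (z + 1)) = ln z + ln (Gamma z)"
  using assms by (subst Gamma_plus1) (auto simp: ln_mult Gamma_real_pos less_imp_neq[symmetric] elim!: nonpos_Ints_cases)

text \<open>The bound does not depend on m, so it survives the limit of m to infinity.\<close>

lemma stirling_error_increment:
  assumes "T \<ge> 0"
  obtains C where "C \<ge> 0" "\<And>x t m. \<bar>t\<bar> \<le> T \<Longrightarrow> x \<ge> 2 * T + 2 \<Longrightarrow>
      \<bar>(ln (Gamma (x + real m + t)) - stirling_approx M (x + real m) t)
        - (ln (Gamma (x + t)) - stirling_approx M x t)\<bar> \<le> C / (x - 1) ^ (M + 1)"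
proof -
  obtain C where C: "C \<ge> 0" "\<And>x t. \<bar>t\<bar> \<le> T \<Longrightarrow> x \<ge> 2 * T + 2 \<Longrightarrow>
      \<bar>stirling_approx M (x + 1) t - stirling_approx M x t - ln (x + t)\<bar> \<le> C / x ^ (M + 2)"
    using stirling_approx_diff_bound[OF assms] by metis
  define E where "E = (\<lambda>x t. ln (Gamma (x + t)) - stirling_approx M x t)"
  \<comment> \<open>The induction needs the subtracted term; it is nonnegative and is dropped
    afterwards.\<close>
  have tele: "\<bar>E (x + real m) t - E x t\<bar> \<le> C * (1 / (x - 1) ^ (M + 1) - 1 / (x + real m - 1) ^ (M + 1))"
    if "\<bar>t\<bar> \<le> T" "x \<ge> 2 * T + 2" for x t m
  proof (induction m)
    case (Suc m)
    define y where "y = x + real m"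
    have y: "y \<ge> 2 * T + 2" "y + t > 0" "y > 1"
      using that assms by (auto simp: y_def)
    have "\<bar>E (y + 1) t - E y t\<bar> = \<bar>stirling_approx M (y + 1) t - stirling_approx M y t - ln (y + t)\<bar>"
      using ln_Gamma_plus_one[OF y(2)] by (simp add: E_def ac_simps)
    also have "\<dots> \<le> C * (1 / y ^ (M + 2))"
      using C(2)[OF that(1) y(1)] by simp
    also have "\<dots> \<le> C * (1 / (y - 1) ^ (M + 1) - 1 / y ^ (M + 1))"
      by (intro mult_left_mono inverse_power_le_diff y C(1))
    finally have "\<bar>E (y + 1) t - E y t\<bar> \<le> C * (1 / (y - 1) ^ (M + 1)) - C * (1 / y ^ (M + 1))"
      by (simp only: right_diff_distrib)
    moreover have "\<bar>E y t - E x t\<bar> \<le> C * (1 / (x - 1) ^ (M + 1)) - C * (1 / (y - 1) ^ (M + 1))"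
      using Suc.IH by (simp only: right_diff_distrib y_def)
    moreover have "x + real (Suc m) = y + 1" "y + 1 - 1 = y"
      by (simp_all add: y_def)
    ultimately show ?case
      by (simp only: right_diff_distrib)
  qed auto
  have "\<bar>E (x + real m) t - E x t\<bar> \<le> C / (x - 1) ^ (M + 1)" if "\<bar>t\<bar> \<le> T" "x \<ge> 2 * T + 2" for x t m
  proof -
    have "C * (1 / (x + real m - 1) ^ (M + 1)) \<ge> 0"
      using C(1) that assms by (intro mult_nonneg_nonneg) auto
    then show ?thesis
      using tele[OF that, of m] by (simp only: right_diff_distrib) simp
  qed
  with C(1) show ?thesis
    by (intro that[of C]) (auto simp: E_def)
qed

section \<open>The constant ln(2 pi)/2\<close>

text \<open>Gauss' product in logarithmic form: \<open>Gamma_series' z n\<close> is (n-1)! n^z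
  divided by the Pochhammer symbol, which equals Gamma(z+n)/Gamma(z), and it tends to
  Gamma(z).\<close>

lemma ln_Gamma_shift_asymp:
  fixes z :: real
  assumes "z > 0"
  shows "(\<lambda>n. ln (Gamma (z + real n)) - ln (Gamma (real n)) - z * ln (real n)) \<longlonglongrightarrow> 0"
proof -
  have "(\<lambda>n. ln (Gamma_series' z n)) \<longlonglongrightarrow> ln (Gamma z)"
    using Gamma_real_pos[OF assms] by (intro tendsto_intros Gamma_series'_LIMSEQ) simp
  then have "(\<lambda>n. ln (Gamma z) - ln (Gamma_series' z n)) \<longlonglongrightarrow> ln (Gamma z) - ln (Gamma z)"
    by (rule tendsto_diff[OF tendsto_const])
  moreover have "\<forall>\<^sub>F n in sequentially. ln (Gamma z) - ln (Gamma_series' z n)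
      = ln (Gamma (z + real n)) - ln (Gamma (real n)) - z * ln (real n)"
    using eventually_gt_at_top[of 0]
  proof eventually_elim
    case (elim n)
    have "Gamma (real n) = fact (n - 1)"
      using elim Gamma_fact[of "n - 1", where 'a = real] by (simp add: of_nat_diff)
    moreover have "pochhammer z n = Gamma (z + real n) / Gamma z"
      using assms by (intro pochhammer_Gamma) (auto elim!: nonpos_Ints_cases)
    moreover have "Gamma z > 0" "Gamma (z + real n) > 0" "Gamma (real n) > 0"
      using assms elim by (auto intro!: Gamma_real_pos)
    ultimately show ?case
      by (simp add: Gamma_series'_def ln_div ln_mult)
  qed
  ultimately show ?thesis
    by (simp add: tendsto_cong)
qed

text \<open>Legendre's duplication formula at n, carried from the complex to the real Gamma
  function.\<close>

lemma ln_Gamma_duplication_nat: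
  assumes "n > 0"
  shows "ln (Gamma (real n)) + ln (Gamma (1 / 2 + real n))
       = (1 - 2 * real n) * ln 2 + ln pi / 2 + ln (Gamma (real (2 * n)))"
proof -
  have "(of_nat n :: complex) \<notin> \<int>\<^sub>\<le>\<^sub>0" "(of_nat n + 1 / 2 :: complex) \<notin> \<int>\<^sub>\<le>\<^sub>0"
    using assms by (auto elim!: nonpos_Ints_cases simp: complex_eq_iff)
  note Gamma_legendre_duplication[OF this]
  moreover have "Gamma (of_nat n :: complex) = of_real (Gamma (real n))"
    using Gamma_complex_of_real[of "real n"] by simp
  moreover have "Gamma (of_nat n + 1 / 2 :: complex) = of_real (Gamma (1 / 2 + real n))"
    using Gamma_complex_of_real[of "1 / 2 + real n"] by (simp add: add.commute)
  moreover have "Gamma (2 * of_nat n :: complex) = of_real (Gamma (real (2 * n)))"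
    using Gamma_complex_of_real[of "real (2 * n)"] by simp
  moreover have "exp ((1 - 2 * of_nat n) * of_real (ln 2)) = complex_of_real (exp ((1 - 2 * real n) * ln 2))"
    by (simp flip: exp_of_real)
  ultimately have "complex_of_real (Gamma (real n) * Gamma (1 / 2 + real n))
      = complex_of_real (exp ((1 - 2 * real n) * ln 2) * sqrt pi * Gamma (real (2 * n)))"
    by (simp only: of_real_mult)
  then have "Gamma (real n) * Gamma (1 / 2 + real n) = exp ((1 - 2 * real n) * ln 2) * sqrt pi * Gamma (real (2 * n))"
    by (simp only: of_real_eq_iff)
  moreover have "Gamma (real n) > 0" "Gamma (1 / 2 + real n) > 0" "Gamma (real (2 * n)) > 0"
    using assms by (auto intro!: Gamma_real_pos)
  ultimately have "ln (Gamma (real n)) + ln (Gamma (1 / 2 + real n))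
      = ln (exp ((1 - 2 * real n) * ln 2) * sqrt pi * Gamma (real (2 * n)))"
    by (metis ln_mult_pos)
  also have "\<dots> = (1 - 2 * real n) * ln 2 + ln pi / 2 + ln (Gamma (real (2 * n)))"
    using \<open>Gamma (real (2 * n)) > 0\<close> by (simp add: ln_mult ln_sqrt)
  finally show ?thesis .
qed

text \<open>Summable increments give convergence; the duplication formula then determines the
  limit.\<close>

lemma ln_Gamma_nat_stirling:
  "(\<lambda>n. ln (Gamma (real n)) - ((real n - 1 / 2) * ln (real n) - real n)) \<longlonglongrightarrow> ln (2 * pi) / 2"
proof -
  define a where "a = (\<lambda>n. ln (Gamma (real n)) - ((real n - 1 / 2) * ln (real n) - real n))"
  \<comment> \<open>The case M = 0, t = 0 of the increment bound, with decay 1/n^2.\<close>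
  obtain C where C: "C \<ge> 0" "\<And>x t. \<bar>t\<bar> \<le> (0 :: real) \<Longrightarrow> x \<ge> 2 * 0 + 2 \<Longrightarrow>
      \<bar>stirling_approx 0 (x + 1) t - stirling_approx 0 x t - ln (x + t)\<bar> \<le> C / x ^ (0 + 2)"
    using stirling_approx_diff_bound[of 0 0] by (metis order_refl)
  have "norm (a (Suc n) - a n) \<le> C * (1 / real n ^ 2)" if "n \<ge> 2" for n
    using C(2)[of 0 "real n"] ln_Gamma_plus_one[of "real n"] that
    by (simp add: a_def stirling_approx_def abs_minus_commute power2_eq_square algebra_simps)
  moreover have "summable (\<lambda>n. C * (1 / real n ^ 2))"
    using inverse_power_summable[of 2, where 'a = real] by (intro summable_mult) (simp add: divide_inverse)
  ultimately have "summable (\<lambda>n. a (Suc n) - a n)"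
    by (intro summable_comparison_test[of "\<lambda>n. a (Suc n) - a n"]) auto
  then have "convergent (\<lambda>n. a n - a 0)"
    by (simp add: summable_iff_convergent sum_lessThan_telescope)
  then have "convergent a"
    using convergent_diff_const_right_iff by blast
  then obtain c where c: "a \<longlonglongrightarrow> c"
    by (auto simp: convergent_def)
  define b where "b = (\<lambda>n. ln (Gamma (1 / 2 + real n)) - ln (Gamma (real n)) - 1 / 2 * ln (real n))"
  \<comment> \<open>The duplication formula says that this combination of convergent sequences is constant.\<close>
  have "(\<lambda>n. a n + b n + (a n - a (2 * n))) \<longlonglongrightarrow> c + 0 + (c - c)"
  proof (intro tendsto_intros c)
    show "b \<longlonglongrightarrow> 0"
      unfolding b_def by (rule ln_Gamma_shift_asymp) simp
    show "(\<lambda>n. a (2 * n)) \<longlonglongrightarrow> c"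
      using LIMSEQ_subseq_LIMSEQ[OF c, of "(*) 2"] by (simp add: o_def strict_mono_def)
  qed
  moreover have "\<forall>\<^sub>F n in sequentially. a n + b n + (a n - a (2 * n)) = ln (2 * pi) / 2"
    using eventually_gt_at_top[of 0]
  proof eventually_elim
    case (elim n)
    then show ?case
      using ln_Gamma_duplication_nat[OF elim] by (simp add: a_def b_def ln_mult field_simps)
  qed
  ultimately have "(\<lambda>n. ln (2 * pi) / 2) \<longlonglongrightarrow> c + 0 + (c - c)"
    by (rule Lim_transform_eventually)
  then have "c = ln (2 * pi) / 2"
    by (simp add: LIMSEQ_const_iff)
  with c show ?thesis
    by (simp add: a_def)
qed

text \<open>Gauss' product reduces the shifted argument to the integer case, so the limit is the
  same for all x and t.\<close>

lemma stirling_error_tendsto: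
  assumes "x > 0" "x + t > 0"
  shows "(\<lambda>n. ln (Gamma (x + real n + t)) - stirling_approx M (x + real n) t) \<longlonglongrightarrow> ln (2 * pi) / 2"
proof -
  define z where "z = x + t"
  \<comment> \<open>The four summands add up to the error at x + n; all but the first tend to
    0.\<close>
  have "(\<lambda>n. (ln (Gamma (real n)) - ((real n - 1 / 2) * ln (real n) - real n))
      + (ln (Gamma (z + real n)) - ln (Gamma (real n)) - z * ln (real n))
      - ((z + real n - 1 / 2) * (ln (x + real n) - ln (real n)) - x)
      - (\<Sum>k=1..M. stirling_coeff k t * (1 / (x + real n) ^ k))) \<longlonglongrightarrow> ln (2 * pi) / 2 + 0 - 0 - (\<Sum>k=1..M. stirling_coeff k t * 0)"
  proof (intro tendsto_diff tendsto_add ln_Gamma_nat_stirling ln_Gamma_shift_asymp tendsto_sum tendsto_mult_left)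
    show "z > 0"
      using assms by (simp add: z_def)
    show "(\<lambda>n. (z + real n - 1 / 2) * (ln (x + real n) - ln (real n)) - x) \<longlonglongrightarrow> 0"
      using assms by real_asymp
    show "(\<lambda>n. 1 / (x + real n) ^ k) \<longlonglongrightarrow> 0" if "k \<in> {1..M}" for k
    proof -
      have "(\<lambda>n. 1 / (x + real n)) \<longlonglongrightarrow> 0"
        by real_asymp
      then have "(\<lambda>n. (1 / (x + real n)) ^ k) \<longlonglongrightarrow> 0 ^ k"
        by (intro tendsto_power)
      then show ?thesis
        using that by (simp add: power_one_over zero_power)
    qed
  qed
  then show ?thesis
    by (simp add: stirling_approx_def z_def algebra_simps)
qed

section \<open>Stirling's series, uniformly for bounded t\<close>

text \<open>Let m tend to infinity in \<open>stirling_error_increment\<close>.\<close>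

lemma ln_Gamma_stirling:
  assumes "T \<ge> 0"
  obtains C where "C \<ge> 0" "\<And>x t. \<bar>t\<bar> \<le> T \<Longrightarrow> x \<ge> 2 * T + 2 \<Longrightarrow>
      \<bar>ln (Gamma (x + t)) - stirling_approx M x t - ln (2 * pi) / 2\<bar> \<le> C / x ^ (M + 1)"
proof -
  obtain C where C: "C \<ge> 0" "\<And>x t m. \<bar>t\<bar> \<le> T \<Longrightarrow> x \<ge> 2 * T + 2 \<Longrightarrow>
      \<bar>(ln (Gamma (x + real m + t)) - stirling_approx M (x + real m) t)
        - (ln (Gamma (x + t)) - stirling_approx M x t)\<bar> \<le> C / (x - 1) ^ (M + 1)"
    using stirling_error_increment[OF assms] by metis
  have "\<bar>ln (Gamma (x + t)) - stirling_approx M x t - ln (2 * pi) / 2\<bar> \<le> C * 2 ^ (M + 1) / x ^ (M + 1)"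
    if t: "\<bar>t\<bar> \<le> T" and x: "x \<ge> 2 * T + 2" for x t
  proof -
    have "(\<lambda>m. \<bar>(ln (Gamma (x + real m + t)) - stirling_approx M (x + real m) t)
        - (ln (Gamma (x + t)) - stirling_approx M x t)\<bar>)
        \<longlonglongrightarrow> \<bar>ln (2 * pi) / 2 - (ln (Gamma (x + t)) - stirling_approx M x t)\<bar>"
      using t x assms by (intro tendsto_intros stirling_error_tendsto) auto
    then have "\<bar>ln (2 * pi) / 2 - (ln (Gamma (x + t)) - stirling_approx M x t)\<bar> \<le> C / (x - 1) ^ (M + 1)"
      by (rule LIMSEQ_le_const2) (use C(2)[OF t x] in auto)
    \<comment> \<open>x >= 2 gives x - 1 >= x/2, at the cost of a factor 2^(M+1).\<close>
    also have "\<dots> \<le> C / (x / 2) ^ (M + 1)"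
      using x assms C(1) by (intro divide_left_mono power_mono mult_pos_pos zero_less_power) auto
    also have "\<dots> = C * 2 ^ (M + 1) / x ^ (M + 1)"
      by (simp add: power_divide)
    finally show ?thesis
      by linarith
  qed
  with C(1) show ?thesis
    by (intro that[of "C * 2 ^ (M + 1)"]) auto
qed

section \<open>Logarithm of the binomial probability\<close>

text \<open>The factorials of N and m are split as n Gamma(n), but that of N - m is not. This
  produces the factor N p / m and gives the last Gamma value the shift 1 - t, to which reflection
  applies.\<close>

lemma ln_binom_prob:
  assumes "0 < m" "m \<le> N" "0 < p" "p < 1"
  shows "binom_prob m N p > 0"
    and "ln (binom_prob m N p) = ln (real N) + ln (Gamma (real N)) - (ln (real m) + ln (Gamma (real m)))
           - ln (Gamma (real N - real m + 1)) + real m * ln p + (real N - real m) * ln (1 - p)"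
proof -
  have fact_eq: "ln (fact n :: real) = ln (real n) + ln (Gamma (real n))" if "n > 0" for n
    using that ln_Gamma_plus_one[of "real n"] Gamma_fact[of n, where 'a = real] by (simp add: add.commute)
  have "ln (fact (N - m) :: real) = ln (Gamma (real N - real m + 1))"
    using assms Gamma_fact[of "N - m", where 'a = real] by (simp add: of_nat_diff algebra_simps)
  moreover have b: "binom_prob m N p = fact N / (fact m * fact (N - m)) * p ^ m * (1 - p) ^ (N - m)"
    using assms by (simp add: binom_prob_def binomial_fact)
  moreover have "ln (fact N / (fact m * fact (N - m)) * p ^ m * (1 - p) ^ (N - m))
      = ln (fact N) - (ln (fact m) + ln (fact (N - m))) + real m * ln p + real (N - m) * ln (1 - p)"
    using assms by (simp add: ln_mult ln_div ln_realpow)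
  ultimately show "ln (binom_prob m N p) = ln (real N) + ln (Gamma (real N)) - (ln (real m) + ln (Gamma (real m)))
           - ln (Gamma (real N - real m + 1)) + real m * ln p + (real N - real m) * ln (1 - p)"
    using assms by (simp add: fact_eq of_nat_diff)
  show "binom_prob m N p > 0"
    using assms by (simp add: b)
qed

text \<open>Reflection removes the sign from the coefficient at 1 - t, so both t-dependent terms are
  multiples of B_(k+1)(t) and their factors combine to \<open>Xi k p\<close>.\<close>

lemma stirling_coeff_combine:
  "stirling_coeff k 0 / x ^ k - stirling_coeff k t / (x * p) ^ k - stirling_coeff k (1 - t) / (x * (1 - p)) ^ k
     = A_tilde k t p / x ^ k"
proof -
  have "stirling_coeff k (1 - t) = bernoulli_poly (k + 1) t / (real k * real (k + 1))"
    by (simp add: stirling_coeff_def bernoulli_poly_reflect flip: power_mult_distrib mult.assoc)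
  moreover define q where "q = 1 - p"
  ultimately show ?thesis
    unfolding A_tilde_def Xi_def bernoulli_num_def q_def[symmetric]
    by (simp add: stirling_coeff_def power_mult_distrib diff_divide_distrib add_divide_distrib algebra_simps)
qed

text \<open>The powers of p and 1 - p cancel the leading logarithmic terms, and the terms linear in
  x cancel since p + (1 - p) = 1. Only half logarithms and the correction sums remain.\<close>

lemma stirling_approx_combine:
  assumes "x > 0" "0 < p" "p < 1" and y: "y = x * p + t"
  shows "stirling_approx M x 0 - stirling_approx M (x * p) t - stirling_approx M (x * (1 - p)) (1 - t)
           + ln x + y * ln p + (x - y) * ln (1 - p)
       = ln (x * p) - ln (x * p * (1 - p)) / 2 + (\<Sum>k=1..M. A_tilde k t p / x ^ k)"
proof -
  have l: "ln (x * p) = ln x + ln p" "ln (x * (1 - p)) = ln x + ln (1 - p)"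
    "ln (x * p * (1 - p)) = ln x + ln p + ln (1 - p)"
    using assms by (simp_all add: ln_mult)
  have "(\<Sum>k=1..M. A_tilde k t p / x ^ k) = (\<Sum>k=1..M. stirling_coeff k 0 / x ^ k)
      - (\<Sum>k=1..M. stirling_coeff k t / (x * p) ^ k) - (\<Sum>k=1..M. stirling_coeff k (1 - t) / (x * (1 - p)) ^ k)"
    by (simp only: stirling_coeff_combine[symmetric] sum_subtractf)
  then show ?thesis
    unfolding stirling_approx_def l y by (simp add: field_simps)
qed

section \<open>Uniform error bounds for the binomial probability\<close>

text \<open>Converts a bound on the error of the logarithm into one on the relative error.\<close>

lemma abs_exp_minus_one_le:
  fixes x :: real
  assumes "\<bar>x\<bar> \<le> 1 / 2"
  shows "\<bar>exp x - 1\<bar> \<le> 2 * \<bar>x\<bar>"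
proof (cases "x \<ge> 0")
  case True
  then show ?thesis
    using assms real_exp_bound_lemma[of x] exp_ge_add_one_self[of x] by simp
next
  case False
  then have "exp x < 1"
    by simp
  then show ?thesis
    using False exp_ge_add_one_self[of x] by linarith
qed

text \<open>The extrema of \<open>K\<close> are attained, hence stay away from 0 and 1. The final
  constants depend on \<open>K\<close> only through this d.\<close>

lemma compact_subset_unit_interval:
  fixes K :: "real set"
  assumes "compact K" "K \<subseteq> {0<..<1}"
  obtains d where "0 < d" "d < 1" "\<And>p. p \<in> K \<Longrightarrow> d \<le> p \<and> d \<le> 1 - p"
proof (cases "K = {}")
  case False
  obtain a where a: "a \<in> K" "\<And>p. p \<in> K \<Longrightarrow> a \<le> p"
    using compact_attains_inf[OF assms(1) False] by blast
  obtain b where b: "b \<in> K" "\<And>p. p \<in> K \<Longrightarrow> p \<le> b"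
    using compact_attains_sup[OF assms(1) False] by blast
  have "0 < a" "a < 1" "b < 1"
    using a b assms(2) by auto
  with a b show ?thesis
    by (intro that[of "min a (1 - b)"]) (auto simp: min_def, force+)
qed (auto intro: that[of "1 / 2"])

text \<open>Stirling's series is used at N, N p and N (1 - p) with shifts 0, t and 1 - t. The
  condition |t| + 1 <= T admits all three shifts, and N d >= 2 T + 2 makes all three arguments large
  enough.\<close>

lemma binom_prob_log_expansion:
  assumes "T \<ge> 1" "0 < d"
  obtains D where "D \<ge> 0" "\<And>N p t m. d \<le> p \<Longrightarrow> d \<le> 1 - p \<Longrightarrow> \<bar>t\<bar> + 1 \<le> T \<Longrightarrow> m \<le> N
    \<Longrightarrow> real m = real N * p + t \<Longrightarrow> real N * d \<ge> 2 * T + 2 \<Longrightarrow>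
      m > 0 \<and> \<bar>ln (binom_prob m N p) - ln (real N * p / real m * (1 / sqrt (2 * pi * real N * p * (1 - p))))
        - (\<Sum>k=1..M. A_tilde k t p / real N ^ k)\<bar> \<le> D / real N ^ (M + 1)"
proof -
  obtain C where C: "C \<ge> 0" "\<And>x t. \<bar>t\<bar> \<le> T \<Longrightarrow> x \<ge> 2 * T + 2 \<Longrightarrow>
      \<bar>ln (Gamma (x + t)) - stirling_approx M x t - ln (2 * pi) / 2\<bar> \<le> C / x ^ (M + 1)"
    using ln_Gamma_stirling[of T M] assms by (metis order_trans zero_le_one)
  \<comment> \<open>One error from N, and two from N p and N (1 - p), where the lower bound N d
    costs d^(-M-1).\<close>
  define D where "D = C + 2 * (C / d ^ (M + 1))"
  have "D \<ge> 0"
    using C(1) assms by (simp add: D_def)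
  moreover have "m > 0 \<and> \<bar>ln (binom_prob m N p) - ln (real N * p / real m * (1 / sqrt (2 * pi * real N * p * (1 - p))))
        - (\<Sum>k=1..M. A_tilde k t p / real N ^ k)\<bar> \<le> D / real N ^ (M + 1)"
    if p: "d \<le> p" "d \<le> 1 - p" and t: "\<bar>t\<bar> + 1 \<le> T" and m: "m \<le> N" "real m = real N * p + t"
      and N: "real N * d \<ge> 2 * T + 2" for N p t m
  proof -
    have p01: "0 < p" "p < 1"
      using p assms by auto
    have Npos: "real N > 0"
      using N assms by (cases "N = 0") auto
    have large: "x \<ge> 2 * T + 2 \<and> C / x ^ (M + 1) \<le> C / d ^ (M + 1) / real N ^ (M + 1)"
      if "x = real N * r" "d \<le> r" for x r
    proof -
      have "real N * d \<le> x"
        using that by (auto intro: mult_left_mono)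
      moreover from this have "C / x ^ (M + 1) \<le> C / (real N * d) ^ (M + 1)"
        using C(1) Npos assms by (intro divide_left_mono power_mono mult_pos_pos zero_less_power) (auto intro: less_le_trans[rotated])
      ultimately show ?thesis
        using N by (simp add: power_mult_distrib ac_simps)
    qed
    have "d \<le> 1"
      using p assms by simp
    have mpos: "real m > 0"
      using large[OF refl p(1)] m(2) t assms(1) by linarith
    have e1: "\<bar>ln (Gamma (real N)) - stirling_approx M (real N) 0 - ln (2 * pi) / 2\<bar> \<le> C / real N ^ (M + 1)"
      using C(2)[of 0 "real N"] large[of "real N" 1] \<open>d \<le> 1\<close> assms by simp
    have e2: "\<bar>ln (Gamma (real m)) - stirling_approx M (real N * p) t - ln (2 * pi) / 2\<bar>
        \<le> C / d ^ (M + 1) / real N ^ (M + 1)"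
      using C(2)[of t "real N * p"] large[OF refl p(1)] m t by simp
    have e3: "\<bar>ln (Gamma (real N - real m + 1)) - stirling_approx M (real N * (1 - p)) (1 - t) - ln (2 * pi) / 2\<bar>
        \<le> C / d ^ (M + 1) / real N ^ (M + 1)"
    proof -
      have eq: "real N - real m + 1 = real N * (1 - p) + (1 - t)"
        using m by (simp add: algebra_simps)
      have "\<bar>1 - t\<bar> \<le> T"
        using t by linarith
      then show ?thesis
        unfolding eq using large[OF refl p(2)] by (intro order_trans[OF C(2)]) auto
    qed
    have "m > 0"
      using mpos by simp
    define target where "target = ln (real N * p / real m * (1 / sqrt (2 * pi * real N * p * (1 - p))))"
    have "target = ln (real N * p) - ln (real m) - (ln (2 * pi) + ln (real N * p * (1 - p))) / 2"
      using mpos Npos p01 by (simp add: target_def ln_mult ln_div ln_sqrt)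
    \<comment> \<open>One minus two copies of ln(2 pi)/2 leave the -ln(2 pi)/2 contained in
      \<open>target\<close>.\<close>
    then have "ln (binom_prob m N p) - target - (\<Sum>k=1..M. A_tilde k t p / real N ^ k)
        = (ln (Gamma (real N)) - stirling_approx M (real N) 0 - ln (2 * pi) / 2)
          - (ln (Gamma (real m)) - stirling_approx M (real N * p) t - ln (2 * pi) / 2)
          - (ln (Gamma (real N - real m + 1)) - stirling_approx M (real N * (1 - p)) (1 - t) - ln (2 * pi) / 2)"
      using stirling_approx_combine[OF Npos p01 m(2), of M] ln_binom_prob(2)[OF \<open>m > 0\<close> m(1) p01]
      by argo
    moreover have "D / real N ^ (M + 1) = C / real N ^ (M + 1) + 2 * (C / d ^ (M + 1) / real N ^ (M + 1))"
      by (simp add: D_def add_divide_distrib)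
    ultimately have "\<bar>ln (binom_prob m N p) - target - (\<Sum>k=1..M. A_tilde k t p / real N ^ k)\<bar> \<le> D / real N ^ (M + 1)"
      using e1 e2 e3 by linarith
    with \<open>m > 0\<close> show ?thesis
      by (simp only: target_def)
  qed
  ultimately show ?thesis
    by (rule that)
qed

theorem theorem2p4:
  fixes K H :: "real set"
  assumes "compact K" and "K \<subseteq> {0<..<1}" and "compact H"
  shows "\<forall>M::nat. \<exists>(C::real) (N0::nat). \<forall>N\<ge>N0. \<forall>p\<in>K. \<forall>t\<in>H. \<forall>m::nat.
           m \<le> N \<and> real m = real N * p + t \<longrightarrow>
             m > 0 \<and>
             (\<exists>\<epsilon>::real.
                binom_prob m N p =
                  real N * p / real m * (1 / sqrt (2 * pi * real N * p * (1 - p)))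
                    * exp (\<Sum>k=1..M. A_tilde k t p / real N ^ k) * (1 + \<epsilon>)
                \<and> \<bar>\<epsilon>\<bar> \<le> C * real N powi (- int M - 1))"
proof
  fix M :: nat
  obtain d where d: "0 < d" "d < 1" "\<And>p. p \<in> K \<Longrightarrow> d \<le> p \<and> d \<le> 1 - p"
    using compact_subset_unit_interval[OF assms(1,2)] by metis
  obtain T0 where T0: "T0 > 0" "\<And>t. t \<in> H \<Longrightarrow> \<bar>t\<bar> \<le> T0"
    using compact_imp_bounded[OF assms(3)] by (auto simp: bounded_pos)
  define T where "T = T0 + 1"
  obtain D where D: "D \<ge> 0" "\<And>N p t m. d \<le> p \<Longrightarrow> d \<le> 1 - p \<Longrightarrow> \<bar>t\<bar> + 1 \<le> T \<Longrightarrow> m \<le> N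
    \<Longrightarrow> real m = real N * p + t \<Longrightarrow> real N * d \<ge> 2 * T + 2 \<Longrightarrow>
      m > 0 \<and> \<bar>ln (binom_prob m N p) - ln (real N * p / real m * (1 / sqrt (2 * pi * real N * p * (1 - p))))
        - (\<Sum>k=1..M. A_tilde k t p / real N ^ k)\<bar> \<le> D / real N ^ (M + 1)"
    using binom_prob_log_expansion[of T d M] T0(1) d(1) by (auto simp: T_def)
  \<comment> \<open>The first entry of the maximum yields N d >= 2 T + 2, the second keeps the
    logarithmic error below 1/2, and the added 1 ensures N >= 1.\<close>
  define N0 where "N0 = nat \<lceil>max ((2 * T + 2) / d) (2 * D)\<rceil> + 1"
  show "\<exists>(C::real) (N0::nat). \<forall>N\<ge>N0. \<forall>p\<in>K. \<forall>t\<in>H. \<forall>m::nat.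
           m \<le> N \<and> real m = real N * p + t \<longrightarrow>
             m > 0 \<and>
             (\<exists>\<epsilon>::real.
                binom_prob m N p =
                  real N * p / real m * (1 / sqrt (2 * pi * real N * p * (1 - p)))
                    * exp (\<Sum>k=1..M. A_tilde k t p / real N ^ k) * (1 + \<epsilon>)
                \<and> \<bar>\<epsilon>\<bar> \<le> C * real N powi (- int M - 1))"
  proof (intro exI[of _ "2 * D"] exI[of _ N0] allI ballI impI)
    fix N p t m
    assume N: "N \<ge> N0" and p: "p \<in> K" and t: "t \<in> H" and m: "m \<le> N \<and> real m = real N * p + t"
    have "real N \<ge> max ((2 * T + 2) / d) (2 * D)" and "N \<ge> 1"
      using N by (auto simp: N0_def) linarith+
    then have Nd: "real N * d \<ge> 2 * T + 2" and ND: "2 * D \<le> real N" and N1: "real N \<ge> 1"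
      using d(1) by (auto simp: field_simps)
    define S where "S = (\<Sum>k=1..M. A_tilde k t p / real N ^ k)"
    define A where "A = real N * p / real m * (1 / sqrt (2 * pi * real N * p * (1 - p)))"
    define \<delta> where "\<delta> = ln (binom_prob m N p) - ln A - S"
    have mpos: "m > 0" and \<delta>: "\<bar>\<delta>\<bar> \<le> D / real N ^ (M + 1)"
      using D(2)[of p t m N] d(3)[OF p] T0(2)[OF t] m Nd by (auto simp: T_def \<delta>_def A_def S_def)
    have p01: "0 < p" "p < 1"
      using p assms(2) by auto
    have "A > 0"
      using p01 mpos N1 by (simp add: A_def)
    moreover have "binom_prob m N p > 0"
      using ln_binom_prob(1)[OF mpos _ p01] m by blast
    \<comment> \<open>The witness for the relative error is \<open>exp \<delta> - 1\<close>.\<close>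
    ultimately have "binom_prob m N p = A * exp S * (1 + (exp \<delta> - 1))"
      by (simp add: \<delta>_def exp_diff)
    moreover have "\<bar>exp \<delta> - 1\<bar> \<le> 2 * D * real N powi (- int M - 1)"
    proof -
      have "real N \<le> real N ^ (M + 1)"
        using N1 by (intro self_le_power) auto
      then have "2 * D \<le> real N ^ (M + 1)" "real N ^ (M + 1) > 0"
        using ND N1 by linarith+
      then have "D / real N ^ (M + 1) \<le> 1 / 2"
        by (simp add: divide_le_eq del: power_Suc)
      then have "\<bar>exp \<delta> - 1\<bar> \<le> 2 * \<bar>\<delta>\<bar>"
        using \<delta> by (intro abs_exp_minus_one_le) linarith
      also have "\<dots> \<le> 2 * (D / real N ^ (M + 1))"
        using \<delta> by simp
      also have "- int M - 1 = - int (M + 1)"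
        by simp
      then have "real N powi (- int M - 1) = 1 / real N ^ (M + 1)"
        by (simp only: power_int_minus power_int_of_nat inverse_eq_divide)
      then have "2 * (D / real N ^ (M + 1)) = 2 * D * real N powi (- int M - 1)"
        by (metis mult.assoc mult_1_right times_divide_eq_right)
      finally show ?thesis .
    qed
    ultimately show "m > 0 \<and>
             (\<exists>\<epsilon>::real.
                binom_prob m N p =
                  real N * p / real m * (1 / sqrt (2 * pi * real N * p * (1 - p)))
                    * exp (\<Sum>k=1..M. A_tilde k t p / real N ^ k) * (1 + \<epsilon>)
                \<and> \<bar>\<epsilon>\<bar> \<le> 2 * D * real N powi (- int M - 1))"
      using mpos unfolding A_def S_def by blast
  qed
qed

end
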